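(* Let $\mathcal{P}_0$ denote the distribution of the adjacency matrix of the Erdős–Rényi graph ${\sf ER}(n,\frac{k}{n-1})$ and, for $\pi\in S_{n-1}$, let $\mathcal{P}_\pi$ denote the distribution of the adjacency matrix of the Watts–Strogatz graph ${\sf WS}(n,k,\beta)$ with hidden permutation $\pi$ (all defined in the context), where $k=k(n)$ and $\beta=\beta(n)$. A selector is any map $\phi:\{0,1\}^{n\times n}\to S_{n-1}\cup\{0\}$. Then for every fixed $0<\alpha<1/8$ there are constants $C_\alpha, C'_\alpha>0$, depending only on $\alpha$, such that $$\varliminf_{n\to\infty}\ \min_{\phi}\ \max\left\{\mathcal{P}_0(\phi\neq 0),\ \frac{1}{(n-1)!}\sum_{\pi\in S_{n-1}}\mathcal{P}_\pi(\phi\neq\pi)\right\}\ \ge\ 1-2\alpha$$ whenever the parameters satisfy $$1-\beta\le C_\alpha\sqrt{\frac{\log n}{n}}\qquad\text{or}\qquad 1-\beta\le C'_\alpha\cdot\frac{\log n}{k}\cdot\frac{1}{\log\frac{n\log n}{k^2}}.$$ In other words, if $1-\beta\prec\sqrt{\frac{\log n}{n}}\vee\frac{\log n}{k}$, then no multiple testing procedure can succeed in distinguishing, with vanishing error, the class of models containing all of ${\sf WS}(n,k,\beta)$ (over $\pi\in S_{n-1}$) and ${\sf ER}(n,\frac{k}{n-1})$; that is, no sequence of selectors $\phi=\phi_n$ makes the maximum in the display above tend to $0$.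
   Context: Parameters: $n$ is the number of nodes, $k$ (even) the neighborhood size, $\beta\in[0,1]$ the rewiring probability. Ring lattice matrix: $B\in\{0,1\}^{n\times n}$ is given by $B_{ij}=1$ if $i\ne j$ and the ring (circular) distance $\min(|i-j|,n-|i-j|)$ is at most $k/2$, and $B_{ij}=0$ otherwise (the paper writes this condition as $0<|i-j|\le\frac k2 \bmod n-1-\frac k2$). For a permutation $\pi$ of the $n$ nodes with permutation matrix $P_\pi$, the convention is $[P_\pi B P_\pi^T]_{ij}=B_{\pi^{-1}(i)\pi^{-1}(j)}$. ${\sf WS}(n,k,\beta)$ with hidden permutation $\pi$: the symmetric random adjacency matrix $A\in\{0,1\}^{n\times n}$ with zero diagonal whose entries $A_{ij}$, $i<j$, are independent, with $A_{ij}\sim{\sf Bernoulli}\left(1-\beta(1-\beta\frac{k}{n-1})\right)$ if $[P_\pi BP_\pi^T]_{ij}=1$ and $A_{ij}\sim{\sf Bernoulli}\left(\beta\frac{k}{n-1}\right)$ if $[P_\pi BP_\pi^T]_{ij}=0$. ${\sf ER}(n,\frac{k}{n-1})$: symmetric $A$ with zero diagonal and $A_{ij}$, $i<j$, i.i.d. ${\sf Bernoulli}(\frac{k}{n-1})$. $S_{n-1}$ (with $(n-1)!$ elements) is viewed as the set of permutations of the $n$ nodes fixing one designated node. The symbol $0$ is an additional decision not in $S_{n-1}$ representing the Erdős–Rényi model. Notation: $a\vee b=\max(a,b)$; $a(n)\prec b(n)$ means $\limsup_{n\to\infty}a(n)/b(n)=0$.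
   Formalization: In the second condition, 1/log(n log n/k²) is replaced by 1/max(1, log(n log n/k²)): as n log n/k² tends to 1 from above the literal threshold blows up, allowing β=0, where the permutation is recoverable up to reflection and the error tends to 1/2 < 1-2α. *)

theory Defs
  imports "HOL-Probability.Probability" "HOL-Combinatorics.Permutations"
begin

text \<open>
  The nodes are \<open>0, \<dots>, n - 1\<close>. A 0-1 matrix of size \<open>n \<times> n\<close> is a function
  \<open>nat \<Rightarrow> nat \<Rightarrow> bool\<close> (\<open>True\<close> for 1) that is \<open>False\<close> outside the index range.
\<close>

definition adj_matrices :: "nat \<Rightarrow> (nat \<Rightarrow> nat \<Rightarrow> bool) set" where
  "adj_matrices n = {A. \<forall>i j. A i j \<longrightarrow> i < n \<and> j < n}"

definition ring_dist :: "nat \<Rightarrow> nat \<Rightarrow> nat \<Rightarrow> int" where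
  "ring_dist n i j = min \<bar>int i - int j\<bar> (int n - \<bar>int i - int j\<bar>)"

definition ring_lattice :: "nat \<Rightarrow> nat \<Rightarrow> nat \<Rightarrow> nat \<Rightarrow> bool" where
  "ring_lattice n k i j \<longleftrightarrow>
     i < n \<and> j < n \<and> i \<noteq> j \<and> real_of_int (ring_dist n i j) \<le> real k / 2"

definition conj_perm :: "(nat \<Rightarrow> nat) \<Rightarrow> (nat \<Rightarrow> nat \<Rightarrow> bool) \<Rightarrow> nat \<Rightarrow> nat \<Rightarrow> bool" where
  "conj_perm \<pi> B i j = B (inv \<pi> i) (inv \<pi> j)"

text \<open>
  The upper triangular entries are independent Bernoulli variables, the entry at \<open>i < j < n\<close>
  having success probability \<open>q i j\<close>. The diagonal and everything out of range receive the
  default value \<open>False\<close> of \<^const>\<open>Pi_pmf\<close>.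
\<close>

definition random_sym_matrix ::
  "nat \<Rightarrow> (nat \<Rightarrow> nat \<Rightarrow> real) \<Rightarrow> (nat \<Rightarrow> nat \<Rightarrow> bool) pmf" where
  "random_sym_matrix n q =
     map_pmf (\<lambda>f i j. f (min i j, max i j))
       (Pi_pmf {(i, j). i < j \<and> j < n} False (\<lambda>(i, j). bernoulli_pmf (q i j)))"

definition ER :: "nat \<Rightarrow> real \<Rightarrow> (nat \<Rightarrow> nat \<Rightarrow> bool) pmf" where
  "ER n p = random_sym_matrix n (\<lambda>i j. p)"

definition WS ::
  "nat \<Rightarrow> nat \<Rightarrow> real \<Rightarrow> (nat \<Rightarrow> nat) \<Rightarrow> (nat \<Rightarrow> nat \<Rightarrow> bool) pmf" where
  "WS n k \<beta> \<pi> = random_sym_matrix n (\<lambda>i j.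
     if conj_perm \<pi> (ring_lattice n k) i j
     then 1 - \<beta> * (1 - \<beta> * (real k / (real n - 1)))
     else \<beta> * (real k / (real n - 1)))"

text \<open>The designated node, fixed by the permutations in \<open>S\<^sub>n\<^sub>-\<^sub>1\<close>, is node 0.\<close>

definition node_perms :: "nat \<Rightarrow> (nat \<Rightarrow> nat) set" where
  "node_perms n = {\<pi>. \<pi> permutes {..<n} \<and> \<pi> 0 = 0}"

text \<open>\<^term>\<open>None\<close> is the additional decision 0 in favour of the Erdos-Renyi model.\<close>

definition selectors :: "nat \<Rightarrow> ((nat \<Rightarrow> nat \<Rightarrow> bool) \<Rightarrow> (nat \<Rightarrow> nat) option) set" where
  "selectors n = adj_matrices n \<rightarrow>\<^sub>E insert None (Some ` node_perms n)"

definition max_error ::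
  "nat \<Rightarrow> nat \<Rightarrow> real \<Rightarrow> ((nat \<Rightarrow> nat \<Rightarrow> bool) \<Rightarrow> (nat \<Rightarrow> nat) option) \<Rightarrow> real" where
  "max_error n k \<beta> \<phi> = max
     (measure_pmf.prob (ER n (real k / (real n - 1))) {A. \<phi> A \<noteq> None})
     (1 / fact (n - 1) *
        (\<Sum>\<pi>\<in>node_perms n. measure_pmf.prob (WS n k \<beta> \<pi>) {A. \<phi> A \<noteq> Some \<pi>}))"

definition minimax_error :: "nat \<Rightarrow> nat \<Rightarrow> real \<Rightarrow> real" where
  "minimax_error n k \<beta> = Min (max_error n k \<beta> ` selectors n)"

definition ws_params :: "nat \<Rightarrow> nat \<Rightarrow> real \<Rightarrow> bool" where
  "ws_params n k \<beta> \<longleftrightarrow> even k \<and> 0 < k \<and> k < n \<and> 0 \<le> \<beta> \<and> \<beta> \<le> 1"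

definition asymp_less :: "(nat \<Rightarrow> real) \<Rightarrow> (nat \<Rightarrow> real) \<Rightarrow> bool" (infix "\<prec>" 50) where
  "a \<prec> b \<longleftrightarrow> limsup (\<lambda>n. ereal (a n / b n)) = 0"

text \<open>
  The logarithm that occurs in a denominator, bounded below by 1. With the plain logarithm the
  threshold \<open>C' * (ln n / k) * (1 / ln (n * ln n / k\<^sup>2))\<close> tends to infinity as \<open>k\<^sup>2\<close>
  approaches \<open>n * ln n\<close> from below, so that it puts no constraint on \<open>\<beta>\<close>, and the lower bound is false
  there: for \<open>\<beta> = 0\<close> the hidden permutation can be recovered up to a reflection.
\<close>

definition ln1 :: "real \<Rightarrow> real" where
  "ln1 x = max 1 (ln x)"

end

theory Submission
  imports Defs "HOL-Real_Asymp.Real_Asymp"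
begin

text \<open>
  The nonasymptotic core is Fano's inequality, applied to the graphs \<open>WS(n, k, \<beta>)\<close> alone: the
  Erdos-Renyi hypothesis can only help the lower bound. The reference measure has i.i.d. edges
  whose probability is the average \<open>q\<close> of the two edge probabilities of the Watts-Strogatz graph
  (and not \<open>k / (n - 1)\<close>, for which the divergence is too large when \<open>k\<close> is close to \<open>n\<close>). The
  relative entropy is a sum over the edges. Bounded by the chi-square divergence it is at most
  \<open>n\<^sup>2 (1 - \<beta>)\<^sup>2 / 2\<close> for all \<open>k\<close>; bounding the lattice edges through
  \<open>d(a, b) \<le> (a - b) (1 + ln (a / b))\<close> instead gives the second regime. Both are at most
  \<open>\<alpha> n ln n\<close>, while \<open>ln (n - 1)! \<sim> n ln n\<close>.

  For the last claim, the reflection \<open>i \<mapsto> - i\<close> of the ring fixes node 0 and the lattice. Hence \<open>\<pi>\<close>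
  and its composition with the reflection give the same distribution, and the average error is at
  least \<open>1/2\<close> for every \<open>\<beta>\<close>.
\<close>

subsection \<open>Relative entropy and Fano's inequality\<close>

text \<open>The Kullback-Leibler divergence, provided that the support of \<open>P\<close> lies in
  that of \<open>Q\<close>: otherwise division by zero would put \<open>ln 0 = 0\<close> in place of
  infinity. Hence the support hypotheses below.\<close>

definition rel_entropy :: "'a pmf \<Rightarrow> 'a pmf \<Rightarrow> real" where
  "rel_entropy P Q = measure_pmf.expectation P (\<lambda>x. ln (pmf P x / pmf Q x))"

text \<open>The variational formula of Donsker and Varadhan for the test function
  \<open>ln M * indicator E\<close>, with the logarithm of its \<open>Q\<close>-integral replaced by
  a linear upper bound. In Fano's inequality \<open>M\<close> becomes the number of
  hypotheses.\<close>

lemma ln_mult_prob_le_rel_entropy: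
  fixes P Q :: "'a pmf" and M :: real
  assumes fin: "finite (set_pmf P)" and sub: "set_pmf P \<subseteq> set_pmf Q" and M: "M \<ge> 1"
  shows "ln M * measure_pmf.prob P E \<le> rel_entropy P Q + (M - 1) * measure_pmf.prob Q E"
proof -
  let ?S = "set_pmf P"
  have pos: "pmf P x > 0" "pmf Q x > 0" if "x \<in> ?S" for x
    using that sub by (auto simp: pmf_positive_iff)
  have pw: "pmf P x * (ln M * indicator E x - ln (pmf P x / pmf Q x))
      \<le> pmf Q x + (M - 1) * (pmf Q x * indicator E x) - pmf P x" if "x \<in> ?S" for x
  proof -
    define c where "c = (if x \<in> E then M else 1)"
    have c: "c > 0" "ln c = ln M * indicator E x" "c = 1 + (M - 1) * indicator E x"
      using M by (auto simp: c_def)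
    \<comment> \<open>Tilting \<open>Q\<close> by the factor \<open>M\<close> on \<open>E\<close> and using \<open>ln y \<le> y - 1\<close>\<close>
    have "ln M * indicator E x - ln (pmf P x / pmf Q x) = ln (c * pmf Q x / pmf P x)"
      using pos[OF that] c by (simp add: ln_div ln_mult)
    also have "\<dots> \<le> c * pmf Q x / pmf P x - 1"
      using pos[OF that] c(1) by (intro ln_le_minus_one) simp
    finally have "pmf P x * (ln M * indicator E x - ln (pmf P x / pmf Q x))
      \<le> pmf P x * (c * pmf Q x / pmf P x - 1)"
      using pos[OF that] by (intro mult_left_mono) auto
    also have "\<dots> = c * pmf Q x - pmf P x"
      using pos[OF that] by (simp add: field_simps)
    finally show ?thesis by (simp add: c(3) algebra_simps)
  qed
  have re: "rel_entropy P Q = (\<Sum>x\<in>?S. pmf P x * ln (pmf P x / pmf Q x))"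
    unfolding rel_entropy_def by (subst integral_measure_pmf_real[OF fin]) (auto simp: mult.commute)
  have prP: "measure_pmf.prob P E = (\<Sum>x\<in>?S. pmf P x * indicator E x)"
  proof -
    have "measure_pmf.prob P E = measure_pmf.prob P (E \<inter> ?S)" by (simp add: measure_Int_set_pmf)
    also have "\<dots> = sum (pmf P) (E \<inter> ?S)" using fin by (simp add: measure_measure_pmf_finite)
    also have "\<dots> = (\<Sum>x\<in>?S. pmf P x * indicator E x)"
      using fin by (simp add: sum.inter_restrict Int_commute indicator_def if_distrib cong: if_cong)
    finally show ?thesis .
  qed
  have SQ: "(\<Sum>x\<in>?S. pmf Q x) \<le> 1"
    using fin by (simp flip: measure_measure_pmf_finite)
  have EQ: "(\<Sum>x\<in>?S. pmf Q x * indicator E x) \<le> measure_pmf.prob Q E"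
  proof -
    have "(\<Sum>x\<in>?S. pmf Q x * indicator E x) = sum (pmf Q) (E \<inter> ?S)"
      using fin by (simp add: sum.inter_restrict Int_commute indicator_def if_distrib cong: if_cong)
    also have "\<dots> = measure_pmf.prob Q (E \<inter> ?S)" using fin by (simp add: measure_measure_pmf_finite)
    also have "\<dots> \<le> measure_pmf.prob Q E" by (intro measure_pmf.finite_measure_mono) auto
    finally show ?thesis .
  qed
  have SP: "(\<Sum>x\<in>?S. pmf P x) = 1" using fin by (simp add: sum_pmf_eq_1)
  have "ln M * measure_pmf.prob P E - rel_entropy P Q
      = (\<Sum>x\<in>?S. pmf P x * (ln M * indicator E x - ln (pmf P x / pmf Q x)))"
    unfolding re prP by (simp add: sum_distrib_left sum_subtractf algebra_simps)
  also have "\<dots> \<le> (\<Sum>x\<in>?S. pmf Q x + (M - 1) * (pmf Q x * indicator E x) - pmf P x)"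
    by (intro sum_mono pw)
  also have "\<dots> = (\<Sum>x\<in>?S. pmf Q x) + (M - 1) * (\<Sum>x\<in>?S. pmf Q x * indicator E x) - 1"
    by (simp add: sum.distrib sum_subtractf sum_distrib_left SP)
  also have "\<dots> \<le> 1 + (M - 1) * measure_pmf.prob Q E - 1"
    using SQ EQ M by (intro diff_mono add_mono mult_left_mono) auto
  finally show ?thesis by simp
qed

text \<open>On the support of the product law the likelihood ratio is a product over coordinates, so
  its logarithm is a sum whose terms each depend on one marginal only.\<close>

lemma rel_entropy_Pi_pmf:
  fixes p q :: "'a \<Rightarrow> 'b pmf"
  assumes A: "finite A" and fin: "\<And>x. x \<in> A \<Longrightarrow> finite (set_pmf (p x))"
    and sub: "\<And>x. x \<in> A \<Longrightarrow> set_pmf (p x) \<subseteq> set_pmf (q x)"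
  shows "rel_entropy (Pi_pmf A d p) (Pi_pmf A d q) = (\<Sum>x\<in>A. rel_entropy (p x) (q x))"
proof -
  let ?P = "Pi_pmf A d p" and ?g = "\<lambda>x y. ln (pmf (p x) y / pmf (q x) y)"
  have finP: "finite (set_pmf ?P)"
    unfolding set_Pi_pmf[OF A] using A fin by (intro finite_PiE_dflt) auto
  have "rel_entropy ?P (Pi_pmf A d q) = measure_pmf.expectation ?P (\<lambda>f. \<Sum>x\<in>A. ?g x (f x))"
    unfolding rel_entropy_def
  proof (intro integral_cong_AE AE_pmfI)
    fix f assume f: "f \<in> set_pmf ?P"
    then have s: "f x = d" if "x \<notin> A" for x
      using that by (auto simp: set_Pi_pmf[OF A] PiE_dflt_def)
    have "f x \<in> set_pmf (p x)" if "x \<in> A" for x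
      using f that by (auto simp: set_Pi_pmf[OF A] PiE_dflt_def)
    then have pos: "pmf (p x) (f x) > 0" "pmf (q x) (f x) > 0" if "x \<in> A" for x
      using that sub by (auto simp: pmf_positive_iff)
    have "pmf ?P f / pmf (Pi_pmf A d q) f = (\<Prod>x\<in>A. pmf (p x) (f x) / pmf (q x) (f x))"
      using s A by (simp add: pmf_Pi prod_dividef)
    also have "ln \<dots> = (\<Sum>x\<in>A. ?g x (f x))"
      using A pos by (intro ln_prod) (auto simp: less_imp_neq[THEN not_sym])
    finally show "ln (pmf ?P f / pmf (Pi_pmf A d q) f) = (\<Sum>x\<in>A. ?g x (f x))" .
  qed auto
  also have "\<dots> = (\<Sum>x\<in>A. measure_pmf.expectation ?P (\<lambda>f. ?g x (f x)))"
    by (intro Bochner_Integration.integral_sum integrable_measure_pmf_finite finP)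
  also have "\<dots> = (\<Sum>x\<in>A. rel_entropy (p x) (q x))"
  proof (intro sum.cong refl)
    fix x assume x: "x \<in> A"
    have "rel_entropy (p x) (q x) = measure_pmf.expectation (map_pmf (\<lambda>f. f x) ?P) (?g x)"
      unfolding rel_entropy_def using x A by (simp add: Pi_pmf_component)
    then show "measure_pmf.expectation ?P (\<lambda>f. ?g x (f x)) = rel_entropy (p x) (q x)" by simp
  qed
  finally show ?thesis .
qed

section \<open>Divergence of Bernoulli laws\<close>

definition bernoulli_rel_entropy :: "real \<Rightarrow> real \<Rightarrow> real" where
  "bernoulli_rel_entropy a b = a * ln (a / b) + (1 - a) * ln ((1 - a) / (1 - b))"

lemma rel_entropy_bernoulli:
  assumes "0 \<le> a" "a \<le> 1" "0 \<le> b" "b \<le> 1"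
  shows "rel_entropy (bernoulli_pmf a) (bernoulli_pmf b) = bernoulli_rel_entropy a b"
  unfolding rel_entropy_def bernoulli_rel_entropy_def
  by (subst integral_measure_pmf_real[of UNIV]) (use assms in \<open>auto simp: UNIV_bool\<close>)

lemma bernoulli_rel_entropy_refl [simp]: "bernoulli_rel_entropy a a = 0"
  by (simp add: bernoulli_rel_entropy_def)

text \<open>\<open>ln y \<le> y - 1\<close> in both logarithms leaves exactly the chi-square
  divergence.\<close>

lemma bernoulli_rel_entropy_le_chi_square:
  assumes "0 \<le> a" "a \<le> 1" "0 < b" "b < 1"
  shows "bernoulli_rel_entropy a b \<le> (a - b)\<^sup>2 / (b * (1 - b))"
proof -
  have *: "x * ln (x / y) \<le> x * (x / y - 1)" if "x \<ge> 0" "y > 0" for x y :: real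
    using that by (cases "x = 0") (auto intro!: mult_left_mono ln_le_minus_one)
  have "bernoulli_rel_entropy a b \<le> a * (a / b - 1) + (1 - a) * ((1 - a) / (1 - b) - 1)"
    unfolding bernoulli_rel_entropy_def using assms by (intro add_mono *) auto
  also have "\<dots> = (a - b)\<^sup>2 / (b * (1 - b))"
    using assms by (simp add: field_simps power2_eq_square)
  finally show ?thesis .
qed

text \<open>For \<open>b \<le> a\<close> the second term is nonpositive, and in the first
  \<open>a\<close> splits as \<open>(a - b) + b\<close>, where
  \<open>b * ln (a / b) \<le> a - b\<close>. When \<open>b\<close> is much smaller than
  \<open>a\<close>, this beats the chi-square bound, which has \<open>b\<close> in the
  denominator.\<close>

lemma bernoulli_rel_entropy_le_ln:
  assumes "0 < b" "b \<le> a" "a \<le> 1" "b < 1"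
  shows "bernoulli_rel_entropy a b \<le> (a - b) * (1 + ln (1 + (a - b) / b))"
proof -
  have "(1 - a) * ln ((1 - a) / (1 - b)) \<le> 0"
    using assms by (cases "a = 1") (auto intro!: mult_nonneg_nonpos simp: divide_simps)
  moreover have "a * ln (a / b) \<le> (a - b) * (1 + ln (1 + (a - b) / b))"
  proof -
    have e: "1 + (a - b) / b = a / b" using assms by (simp add: field_simps)
    have "b * ln (a / b) \<le> b * (a / b - 1)"
      using assms by (intro mult_left_mono ln_le_minus_one) auto
    also have "\<dots> = a - b" using assms by (simp add: field_simps)
    finally show ?thesis unfolding e by (simp add: algebra_simps)
  qed
  ultimately show ?thesis unfolding bernoulli_rel_entropy_def by simp
qed

text \<open>Take \<open>M = card I\<close> in the change of measure: the decision regions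
  \<open>E i\<close> are disjoint, so their \<open>Q\<close>-probabilities add up to at most 1 and
  their terms contribute at most \<open>M - 1\<close> in total.\<close>

lemma fano:
  fixes P :: "'i \<Rightarrow> 'a pmf" and Q :: "'a pmf" and K :: real
  assumes I: "finite I" "I \<noteq> {}" and disj: "disjoint_family_on E I"
    and fin: "\<And>i. i \<in> I \<Longrightarrow> finite (set_pmf (P i))"
    and sub: "\<And>i. i \<in> I \<Longrightarrow> set_pmf (P i) \<subseteq> set_pmf Q"
    and bound: "\<And>i. i \<in> I \<Longrightarrow> rel_entropy (P i) Q \<le> K"
  shows "ln (card I) * (\<Sum>i\<in>I. measure_pmf.prob (P i) (E i)) \<le> card I * (K + 1)"
proof -
  let ?M = "real (card I)"
  have M: "?M \<ge> 1" using I by (simp add: Suc_leI card_gt_0_iff)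
  have "(\<Sum>i\<in>I. measure_pmf.prob Q (E i)) = measure_pmf.prob Q (\<Union>i\<in>I. E i)"
    using I disj by (intro measure_pmf.finite_measure_finite_Union[symmetric]) auto
  then have 1: "(\<Sum>i\<in>I. measure_pmf.prob Q (E i)) \<le> 1" by simp
  have "ln ?M * (\<Sum>i\<in>I. measure_pmf.prob (P i) (E i))
      \<le> (\<Sum>i\<in>I. K + (?M - 1) * measure_pmf.prob Q (E i))"
    unfolding sum_distrib_left
  proof (intro sum_mono)
    fix i assume i: "i \<in> I"
    show "ln ?M * measure_pmf.prob (P i) (E i) \<le> K + (?M - 1) * measure_pmf.prob Q (E i)"
      using ln_mult_prob_le_rel_entropy[OF fin[OF i] sub[OF i] M, of "E i"] bound[OF i] by simp
  qed
  also have "\<dots> = ?M * K + (?M - 1) * (\<Sum>i\<in>I. measure_pmf.prob Q (E i))"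
    by (simp add: sum.distrib sum_distrib_left)
  also have "\<dots> \<le> ?M * K + (?M - 1) * 1"
    using 1 M by (intro add_mono mult_left_mono) auto
  also have "\<dots> \<le> ?M * (K + 1)" by (simp add: algebra_simps)
  finally show ?thesis .
qed

subsection \<open>Counting edges and permutations\<close>

text \<open>Half of Stirling's formula. The increment of \<open>n ln n - n\<close> is controlled by
  \<open>ln (1 + 1 / n) \<le> 1 / n\<close>, which is why the step from 0 is separate.\<close>

lemma ln_fact_ge: "real n * ln (real n) - real n \<le> ln (fact n)"
proof (induction n)
  case (Suc n)
  show ?case
  proof (cases "n = 0")
    case False
    have "ln (real (Suc n) / real n) \<le> real (Suc n) / real n - 1"
      using False by (intro ln_le_minus_one) auto
    then have "ln (real (Suc n)) - ln (real n) \<le> 1 / real n"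
      using False by (simp add: ln_div field_simps)
    then have "real n * (ln (real (Suc n)) - ln (real n)) \<le> real n * (1 / real n)"
      by (intro mult_left_mono) auto
    then have "real (Suc n) * ln (real (Suc n)) - real (Suc n)
        \<le> real n * ln (real n) - real n + ln (real (Suc n))"
      using False by (simp add: algebra_simps)
    also have "\<dots> \<le> ln (fact n) + ln (real (Suc n))" using Suc.IH by simp
    also have "\<dots> = ln (fact (Suc n))" by (simp add: ln_mult add.commute)
    finally show ?thesis .
  qed simp
qed simp

text \<open>By Stirling the right side is about 2\<alpha> n ln n, twice the leading term on the
  left; the gap absorbs the lower-order terms and the \<open>+ 1\<close> of Fano's
  inequality.\<close>

lemma eventually_le_ln_fact:
  assumes "0 < \<alpha>"
  shows "\<forall>\<^sub>F n in sequentially.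
    \<alpha> * (real n * ln (real n)) + 1 \<le> 2 * \<alpha> * ln (fact (n - 1))"
proof -
  have "\<forall>\<^sub>F n in sequentially.
     \<alpha> * (real n * ln (real n)) + 1 \<le> 2 * \<alpha> * ((real n - 1) * ln (real n - 1) - (real n - 1))"
    using assms by real_asymp
  then show ?thesis
    using eventually_ge_at_top[of 1]
  proof eventually_elim
    case (elim n)
    have "2 * \<alpha> * (real (n - 1) * ln (real (n - 1)) - real (n - 1)) \<le> 2 * \<alpha> * ln (fact (n - 1))"
      using assms by (intro mult_left_mono ln_fact_ge) auto
    with elim show ?case by (simp add: of_nat_diff)
  qed
qed

section \<open>Pairs of nodes and lattice edges\<close>

definition pairs :: "nat \<Rightarrow> (nat \<times> nat) set" where
  "pairs n = {(i, j). i < j \<and> j < n}"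

lemma finite_pairs [simp]: "finite (pairs n)"
  unfolding pairs_def by (rule finite_subset[where B = "{..<n} \<times> {..<n}"]) auto

lemma card_Sigma_pairs:
  assumes "D \<subseteq> {1..<n}"
  shows "card {(i, j). i < j \<and> j < n \<and> j - i \<in> D} = (\<Sum>d\<in>D. n - d)"
proof -
  have "bij_betw (\<lambda>(d, i). (i, i + d)) (Sigma D (\<lambda>d. {..<n - d})) {(i, j). i < j \<and> j < n \<and> j - i \<in> D}"
    using assms by (intro bij_betw_byWitness[where f' = "\<lambda>(i, j). (j - i, i)"]) force+
  then have "card {(i, j). i < j \<and> j < n \<and> j - i \<in> D} = card (Sigma D (\<lambda>d. {..<n - d}))"
    by (simp add: bij_betw_same_card)
  also have "\<dots> = (\<Sum>d\<in>D. n - d)"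
    using finite_subset[OF assms] by (subst card_SigmaI) auto
  finally show ?thesis .
qed

lemma card_pairs: "real (card (pairs n)) = real n * (real n - 1) / 2"
proof (induction n)
  case (Suc n)
  have "pairs (Suc n) = pairs n \<union> (\<lambda>i. (i, n)) ` {..<n}"
    by (auto simp: pairs_def image_iff less_Suc_eq)
  moreover have "card (pairs n \<union> (\<lambda>i. (i, n)) ` {..<n}) = card (pairs n) + card ((\<lambda>i. (i, n)) ` {..<n})"
    by (intro card_Un_disjoint finite_pairs) (auto simp: pairs_def)
  ultimately show ?case using Suc.IH by (simp add: card_image inj_on_def field_simps)
qed (simp add: pairs_def)

lemma ring_lattice_iff:
  assumes "i < j" "j < n" "even k"
  shows "ring_lattice n k i j \<longleftrightarrow> j - i \<le> k div 2 \<or> n - (j - i) \<le> k div 2"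
proof -
  have "ring_lattice n k i j \<longleftrightarrow> min (j - i) (n - (j - i)) \<le> k div 2"
  proof -
    have "ring_dist n i j = int (min (j - i) (n - (j - i)))"
      using assms by (auto simp: ring_dist_def)
    moreover have "real k / 2 = real (k div 2)" using assms by auto
    ultimately show ?thesis using assms by (auto simp: ring_lattice_def)
  qed
  then show ?thesis by (simp add: min_le_iff_disj)
qed

text \<open>Ring distance \<open>d\<close> arises from the index differences \<open>d\<close> and
  \<open>n - d\<close>, with \<open>n - d\<close> and \<open>d\<close> pairs, hence \<open>n\<close>
  pairs for each \<open>d\<close> up to \<open>k div 2\<close>. As \<open>k < n\<close>, the two
  ranges of differences do not meet.\<close>

lemma card_ring_lattice:
  assumes "even k" "k < n"
  shows "card {(i, j) \<in> pairs n. ring_lattice n k i j} = n * (k div 2)"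
proof -
  let ?m = "k div 2"
  define D where "D = {1..?m} \<union> {n - ?m..<n}"
  have m: "2 * ?m < n" using assms by auto
  have "{(i, j) \<in> pairs n. ring_lattice n k i j} = {(i, j). i < j \<and> j < n \<and> j - i \<in> D}"
    using assms m by (auto simp: pairs_def D_def ring_lattice_iff)
  also have "card \<dots> = (\<Sum>d\<in>D. n - d)"
    using m by (intro card_Sigma_pairs) (auto simp: D_def)
  also have "\<dots> = (\<Sum>d\<in>{1..?m}. n - d) + (\<Sum>d\<in>{n - ?m..<n}. n - d)"
    unfolding D_def using m by (intro sum.union_disjoint) auto
  also have "(\<Sum>d\<in>{n - ?m..<n}. n - d) = (\<Sum>d\<in>{1..?m}. d)"
    using m by (intro sum.reindex_bij_witness[of _ "\<lambda>d. n - d" "\<lambda>d. n - d"]) auto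
  also have "(\<Sum>d\<in>{1..?m}. n - d) + (\<Sum>d\<in>{1..?m}. d) = (\<Sum>d\<in>{1..?m}. n)"
    unfolding sum.distrib[symmetric] using m by (intro sum.cong) auto
  finally show ?thesis by simp
qed

lemma ring_lattice_sym: "ring_lattice n k i j \<longleftrightarrow> ring_lattice n k j i"
  by (auto simp: ring_lattice_def ring_dist_def abs_minus_commute)

text \<open>A permutation of the nodes permutes the unordered pairs; \<open>h\<close> sorts the
  image of a pair, which is harmless for symmetric \<open>B\<close>. This makes the relative entropy
  independent of the hidden permutation.\<close>

lemma sum_conj_perm:
  assumes "\<pi> permutes {..<n}" and sym: "\<And>i j. B i j = B j i"
  shows "(\<Sum>(i, j)\<in>pairs n. g (conj_perm \<pi> B i j)) = (\<Sum>(i, j)\<in>pairs n. g (B i j))"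
proof -
  define h where "h \<sigma> e = (min (\<sigma> (fst e)) (\<sigma> (snd e)), max (\<sigma> (fst e)) (\<sigma> (snd e)))"
    for \<sigma> :: "nat \<Rightarrow> nat" and e :: "nat \<times> nat"
  have h: "h \<sigma> e \<in> pairs n \<and> h (inv \<sigma>) (h \<sigma> e) = e"
    if \<sigma>: "\<sigma> permutes {..<n}" and e: "e \<in> pairs n" for \<sigma> e
  proof -
    obtain i j where ij: "e = (i, j)" "i < j" "j < n" using e by (auto simp: pairs_def)
    have "\<sigma> i < n" "\<sigma> j < n" using permutes_in_image[OF \<sigma>] ij by auto
    moreover have "\<sigma> i \<noteq> \<sigma> j" using permutes_inj[OF \<sigma>] ij by (auto dest: injD)
    ultimately show ?thesis
      using ij permutes_inverses[OF \<sigma>] by (auto simp: h_def pairs_def min_def max_def)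
  qed
  have \<pi>': "inv \<pi> permutes {..<n}" and inv: "inv (inv \<pi>) = \<pi>"
    using assms(1) by (auto simp: permutes_inv permutes_inv_inv)
  show ?thesis
  proof (rule sum.reindex_bij_witness[of _ "h \<pi>" "h (inv \<pi>)"])
    fix e assume e: "e \<in> pairs n"
    show "h \<pi> (h (inv \<pi>) e) = e" "h (inv \<pi>) e \<in> pairs n"
      using h[OF \<pi>' e] inv by auto
    show "h (inv \<pi>) (h \<pi> e) = e" "h \<pi> e \<in> pairs n"
      using h[OF assms(1) e] by auto
    show "(case h (inv \<pi>) e of (i, j) \<Rightarrow> g (B i j)) = (case e of (i, j) \<Rightarrow> g (conj_perm \<pi> B i j))"
      by (auto simp: h_def conj_perm_def min_def max_def sym split: prod.splits)
  qed
qed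

section \<open>Hidden permutations and selectors as finite sets\<close>

lemma node_perms_eq: "n > 0 \<Longrightarrow> node_perms n = {\<pi>. \<pi> permutes {1..<n}}"
  by (auto simp: node_perms_def permutes_def)
     (metis Suc_leI atLeastLessThan_iff lessThan_iff not_less_zero neq0_conv One_nat_def)+

lemma card_node_perms: "n > 0 \<Longrightarrow> card (node_perms n) = fact (n - 1)"
  by (simp add: node_perms_eq card_permutations)

lemma finite_node_perms: "finite (node_perms n)"
  by (rule finite_subset[OF _ finite_permutations[of "{..<n}"]]) (auto simp: node_perms_def)

lemma finite_adj_matrices: "finite (adj_matrices n)"
proof (rule finite_subset)
  show "adj_matrices n \<subseteq> (\<lambda>S i j. (i, j) \<in> S) ` Pow ({..<n} \<times> {..<n})"
  proof
    fix A assume "A \<in> adj_matrices n"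
    then show "A \<in> (\<lambda>S i j. (i, j) \<in> S) ` Pow ({..<n} \<times> {..<n})"
      by (intro image_eqI[of _ _ "{(i, j). A i j}"]) (auto simp: adj_matrices_def)
  qed
qed simp

text \<open>Together with nonemptiness this gives the \<open>Min\<close> in
  \<open>minimax_error\<close> its meaning. Finiteness holds because the extensional function space
  fixes the values of a selector off \<open>adj_matrices n\<close>.\<close>

lemma finite_selectors: "finite (selectors n)"
  unfolding selectors_def by (intro finite_PiE finite_adj_matrices) (simp add: finite_node_perms)

lemma selectors_nonempty: "selectors n \<noteq> {}"
  unfolding selectors_def by (simp add: PiE_eq_empty_iff)

subsection \<open>Relative entropy of the Watts-Strogatz graph\<close>

lemma ws_params_bounds:
  assumes params: "ws_params n k \<beta>" and p: "p = real k / (real n - 1)"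
  shows p_bounds: "0 < p" "p \<le> 1" and beta_bounds: "0 \<le> \<beta>" "\<beta> \<le> 1"
    and n_ge: "n \<ge> 3" and p_edges: "(real n - 1) * p = real k"
proof -
  have k: "2 \<le> k" "k < n" using params by (auto simp: ws_params_def elim!: evenE)
  then have "real k \<le> real n - 1" "real n - 1 > 0" by linarith+
  with k show "0 < p" "p \<le> 1" "(real n - 1) * p = real k" "n \<ge> 3" by (auto simp: p)
  show "0 \<le> \<beta>" "\<beta> \<le> 1" using params by (auto simp: ws_params_def)
qed

definition q_in :: "real \<Rightarrow> real \<Rightarrow> real" where "q_in \<beta> p = 1 - \<beta> * (1 - \<beta> * p)"
definition q_out :: "real \<Rightarrow> real \<Rightarrow> real" where "q_out \<beta> p = \<beta> * p"
text \<open>\<open>p\<close> is the proportion of lattice edges among all pairs, so this is the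
  expected edge density of the Watts-Strogatz graph, the best parameter for an i.i.d. reference
  measure.\<close>

definition q_avg :: "real \<Rightarrow> real \<Rightarrow> real" where "q_avg \<beta> p = p * q_in \<beta> p + (1 - p) * q_out \<beta> p"

lemma q_avg_eq: "q_avg \<beta> p = p * (1 - \<beta> * (1 - \<beta>) * p)"
  by (simp add: q_avg_def q_in_def q_out_def algebra_simps)

text \<open>The gap between \<open>q_in\<close> and \<open>q_out\<close> is
  \<open>(1 - \<beta>) * (1 - \<beta> * p)\<close>; the average divides it in the ratio
  \<open>1 - p\<close> to \<open>p\<close>.\<close>

lemma q_in_minus_q_avg: "q_in \<beta> p - q_avg \<beta> p = (1 - p) * ((1 - \<beta>) * (1 - \<beta> * p))"
  by (simp add: q_avg_def q_in_def q_out_def algebra_simps)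

lemma q_out_minus_q_avg: "q_out \<beta> p - q_avg \<beta> p = - (p * ((1 - \<beta>) * (1 - \<beta> * p)))"
  by (simp add: q_avg_def q_in_def q_out_def algebra_simps)

context
  fixes \<beta> p :: real
  assumes \<beta>: "0 \<le> \<beta>" "\<beta> \<le> 1" and p: "0 < p" "p \<le> 1"
begin

lemma q_in_bounds: "0 \<le> q_in \<beta> p" "q_in \<beta> p \<le> 1"
  and q_out_bounds: "0 \<le> q_out \<beta> p" "q_out \<beta> p \<le> 1"
proof -
  have bp: "0 \<le> \<beta> * p" "\<beta> * p \<le> 1" using \<beta> p by (auto intro: mult_le_one)
  then show "0 \<le> q_out \<beta> p" "q_out \<beta> p \<le> 1" by (auto simp: q_out_def)
  have "\<beta> * (1 - \<beta> * p) \<le> 1" "0 \<le> \<beta> * (1 - \<beta> * p)"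
    using bp \<beta> by (auto intro: mult_le_one)
  then show "0 \<le> q_in \<beta> p" "q_in \<beta> p \<le> 1" by (auto simp: q_in_def)
qed

text \<open>The first bound rests on \<open>\<beta> * (1 - \<beta>) \<le> 1 / 4\<close> and serves
  the logarithmic estimate; the second supplies the factor \<open>1 - \<beta> * p\<close> that
  cancels in the chi-square estimate.\<close>

lemma q_avg_ge: "3 / 4 * p \<le> q_avg \<beta> p" "p * (1 - \<beta> * p) \<le> q_avg \<beta> p"
proof -
  have "0 \<le> (\<beta> - 1 / 2)\<^sup>2" by simp
  then have "\<beta> * (1 - \<beta>) \<le> 1 / 4" by (simp add: power2_eq_square algebra_simps)
  then have "\<beta> * (1 - \<beta>) * p \<le> 1 / 4 * 1" using p \<beta> by (intro mult_mono) auto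
  then have "p * (3 / 4) \<le> p * (1 - \<beta> * (1 - \<beta>) * p)"
    using p by (intro mult_left_mono) auto
  then show "3 / 4 * p \<le> q_avg \<beta> p" by (simp add: q_avg_eq mult.commute)
  have "\<beta> * (1 - \<beta>) * p \<le> \<beta> * 1 * p" using p \<beta> by (intro mult_right_mono mult_left_mono) auto
  then show "p * (1 - \<beta> * p) \<le> q_avg \<beta> p"
    unfolding q_avg_eq using p by (intro mult_left_mono) auto
qed

lemma q_avg_pos: "0 < q_avg \<beta> p"
  using q_avg_ge(1) p by linarith

lemma q_avg_le: "q_avg \<beta> p \<le> p"
  unfolding q_avg_eq using \<beta> p by (intro mult_left_le) auto

text \<open>With \<open>s = 1 - \<beta> * p\<close>, the denominator is at least
  \<open>p * s * (1 - p)\<close>: this cancels \<open>p * (1 - p)\<close> and one factor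
  \<open>s\<close>, so the bound stays uniform as \<open>p\<close> approaches 1.\<close>

lemma chi_square_le:
  assumes "p < 1"
  shows "p * (1 - p) * ((1 - \<beta>) * (1 - \<beta> * p))\<^sup>2 / (q_avg \<beta> p * (1 - q_avg \<beta> p)) \<le> (1 - \<beta>)\<^sup>2"
proof -
  define s where "s = 1 - \<beta> * p"
  have "\<beta> * p \<le> 1 * p" using \<beta> p by (intro mult_right_mono) auto
  then have "\<beta> * p < 1" using assms by linarith
  moreover have "0 \<le> \<beta> * p" using \<beta> p by simp
  ultimately have s: "0 < s" "s \<le> 1" by (auto simp: s_def)
  have "p * (1 - p) * ((1 - \<beta>) * s)\<^sup>2 / (q_avg \<beta> p * (1 - q_avg \<beta> p))
      \<le> p * (1 - p) * ((1 - \<beta>) * s)\<^sup>2 / ((p * s) * (1 - p))"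
    using p assms s q_avg_ge(2) q_avg_le q_avg_pos
    by (intro divide_left_mono mult_mono mult_pos_pos) (auto simp: s_def)
  also have "\<dots> = (1 - \<beta>)\<^sup>2 * s"
    using p assms s by (simp add: field_simps power2_eq_square)
  also have "\<dots> \<le> (1 - \<beta>)\<^sup>2" using s by (intro mult_left_le) auto
  finally show ?thesis by (simp add: s_def)
qed

text \<open>The factor \<open>1 - p\<close> is the proportion of pairs outside the lattice. In this
  bound and its companion for lattice edges, the weights \<open>p\<close> and \<open>1 - p\<close>
  on the right add up to 1.\<close>

lemma bernoulli_rel_entropy_out_le:
  "(1 - p) * bernoulli_rel_entropy (q_out \<beta> p) (q_avg \<beta> p) \<le> p * (1 - \<beta>)\<^sup>2"
proof (cases "p < 1")
  case True
  let ?D = "(1 - \<beta>) * (1 - \<beta> * p)" and ?v = "q_avg \<beta> p * (1 - q_avg \<beta> p)"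
  have "(1 - p) * bernoulli_rel_entropy (q_out \<beta> p) (q_avg \<beta> p)
      \<le> (1 - p) * ((q_out \<beta> p - q_avg \<beta> p)\<^sup>2 / ?v)"
    using True q_avg_pos q_avg_le q_out_bounds
    by (intro mult_left_mono bernoulli_rel_entropy_le_chi_square) auto
  also have "\<dots> = p * (p * (1 - p) * ?D\<^sup>2 / ?v)"
    unfolding q_out_minus_q_avg by (simp add: power2_eq_square mult_ac)
  also have "\<dots> \<le> p * (1 - \<beta>)\<^sup>2"
    using p True by (intro mult_left_mono chi_square_le) auto
  finally show ?thesis .
qed (use p in auto)

lemma bernoulli_rel_entropy_in_le:
  "p * bernoulli_rel_entropy (q_in \<beta> p) (q_avg \<beta> p) \<le> (1 - p) * (1 - \<beta>)\<^sup>2"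
proof (cases "p < 1")
  case True
  let ?D = "(1 - \<beta>) * (1 - \<beta> * p)" and ?v = "q_avg \<beta> p * (1 - q_avg \<beta> p)"
  have "p * bernoulli_rel_entropy (q_in \<beta> p) (q_avg \<beta> p)
      \<le> p * ((q_in \<beta> p - q_avg \<beta> p)\<^sup>2 / ?v)"
    using True p q_avg_pos q_avg_le q_in_bounds
    by (intro mult_left_mono bernoulli_rel_entropy_le_chi_square) auto
  also have "\<dots> = (1 - p) * (p * (1 - p) * ?D\<^sup>2 / ?v)"
    unfolding q_in_minus_q_avg by (simp add: power2_eq_square mult_ac)
  also have "\<dots> \<le> (1 - p) * (1 - \<beta>)\<^sup>2"
    using p True by (intro mult_left_mono chi_square_le) auto
  finally show ?thesis .
next
  case False
  \<comment> \<open>Every pair is then a lattice edge, and \<open>q_avg\<close> coincides with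
    \<open>q_in\<close>.\<close>
  then have "p = 1" using p by simp
  then show ?thesis by (simp add: q_avg_def)
qed

text \<open>The rise from \<open>q_avg\<close> to \<open>q_in\<close> is at most
  \<open>1 - \<beta>\<close>, and relative to \<open>q_avg \<ge> 3 / 4 * p\<close> it is at most
  \<open>4 * (1 - \<beta>) / (3 * p)\<close>; the logarithmic bound is monotone in both
  quantities.\<close>

lemma bernoulli_rel_entropy_in_le_ln:
  "bernoulli_rel_entropy (q_in \<beta> p) (q_avg \<beta> p)
     \<le> (1 - \<beta>) * (1 + ln (1 + 4 * (1 - \<beta>) / (3 * p)))"
proof (cases "p < 1")
  case True
  let ?\<delta> = "q_in \<beta> p - q_avg \<beta> p"
  have bp: "0 \<le> 1 - \<beta> * p" "1 - \<beta> * p \<le> 1" using \<beta> p by (auto intro: mult_le_one)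
  have d0: "0 \<le> ?\<delta>" unfolding q_in_minus_q_avg using bp \<beta> p by simp
  have "(1 - p) * ((1 - \<beta>) * (1 - \<beta> * p)) \<le> 1 * ((1 - \<beta>) * 1)"
    using bp \<beta> p by (intro mult_mono) auto
  then have d1: "?\<delta> \<le> 1 - \<beta>" unfolding q_in_minus_q_avg by simp
  have "?\<delta> / q_avg \<beta> p \<le> (1 - \<beta>) / (3 / 4 * p)"
    using d0 d1 q_avg_ge(1) p by (intro frac_le) auto
  also have "\<dots> = 4 * (1 - \<beta>) / (3 * p)" by simp
  finally have r: "?\<delta> / q_avg \<beta> p \<le> 4 * (1 - \<beta>) / (3 * p)" .
  have r0: "0 \<le> ?\<delta> / q_avg \<beta> p" using d0 q_avg_pos by simp
  have "bernoulli_rel_entropy (q_in \<beta> p) (q_avg \<beta> p) \<le> ?\<delta> * (1 + ln (1 + ?\<delta> / q_avg \<beta> p))"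
    using d0 True q_avg_pos q_avg_le q_in_bounds by (intro bernoulli_rel_entropy_le_ln) auto
  also have "\<dots> \<le> (1 - \<beta>) * (1 + ln (1 + 4 * (1 - \<beta>) / (3 * p)))"
    using d0 d1 r r0 \<beta> p by (intro mult_mono add_mono) (auto intro!: add_nonneg_nonneg)
  finally show ?thesis .
next
  case False
  then have "p = 1" using p by simp
  then show ?thesis using \<beta> by (simp add: q_avg_def)
qed

end

section \<open>Relative entropy of the whole edge vector\<close>

definition ws_rel_entropy :: "nat \<Rightarrow> nat \<Rightarrow> real \<Rightarrow> real" where
  "ws_rel_entropy n k \<beta> = (let p = real k / (real n - 1) in real n * (real n - 1) / 2 *
     (p * bernoulli_rel_entropy (q_in \<beta> p) (q_avg \<beta> p) +
      (1 - p) * bernoulli_rel_entropy (q_out \<beta> p) (q_avg \<beta> p)))"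

text \<open>The extreme case \<open>p = 1\<close>: here \<open>n\<close> is odd and no two nodes are
  further apart than \<open>(n - 1) / 2 = k / 2\<close>.\<close>

lemma ring_lattice_complete:
  assumes "even k" "Suc k = n" "i < n" "j < n" "i \<noteq> j"
  shows "ring_lattice n k i j"
proof -
  have "2 * ring_dist n i j \<le> int n" unfolding ring_dist_def min_def by auto
  then have "2 * ring_dist n i j \<le> int k + 1" using assms(2) by linarith
  \<comment> \<open>Both sides are even apart from the extra 1, which can therefore be
    dropped.\<close>
  then have "2 * ring_dist n i j \<le> int k" using assms(1) by presburger
  then have "real_of_int (2 * ring_dist n i j) \<le> real_of_int (int k)" by (simp only: of_int_le_iff)
  then show ?thesis using assms by (simp add: ring_lattice_def)
qed

text \<open>Fano's inequality for the vectors of independent upper triangular entries, where the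
  divergence is a sum. The decision regions of \<open>\<phi>\<close> are pulled back along the
  symmetrization \<open>h\<close>.\<close>

lemma sum_prob_correct_le:
  assumes params: "ws_params n k \<beta>"
  shows "ln (fact (n - 1)) * (\<Sum>\<pi>\<in>node_perms n. measure_pmf.prob (WS n k \<beta> \<pi>) {A. \<phi> A = Some \<pi>})
    \<le> fact (n - 1) * (ws_rel_entropy n k \<beta> + 1)"
proof -
  define p where "p = real k / (real n - 1)"
  note pb = p_bounds[OF params p_def] and bb = beta_bounds[OF params p_def]
    and n3 = n_ge[OF params p_def] and pe = p_edges[OF params p_def]
  have ek: "even k" "k < n" using params by (auto simp: ws_params_def)
  define f where "f b = (if b then q_in \<beta> p else q_out \<beta> p)" for b
  define B where "B = ring_lattice n k"
  define h where "h = (\<lambda>(f :: nat \<times> nat \<Rightarrow> bool) i j. f (min i j, max i j))"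
  define P where "P \<pi> = Pi_pmf (pairs n) False (\<lambda>(i, j). bernoulli_pmf (f (conj_perm \<pi> B i j)))" for \<pi>
  define Q where "Q = Pi_pmf (pairs n) False (\<lambda>_. bernoulli_pmf (q_avg \<beta> p))"
  have f: "0 \<le> f b" "f b \<le> 1" for b
    using q_in_bounds[OF bb pb] q_out_bounds[OF bb pb] by (auto simp: f_def)
  have qa: "0 < q_avg \<beta> p" "q_avg \<beta> p \<le> p" using q_avg_pos[OF bb pb] q_avg_le[OF bb pb] by auto
  have WS: "WS n k \<beta> \<pi> = map_pmf h (P \<pi>)" for \<pi>
    unfolding WS_def random_sym_matrix_def h_def P_def f_def pairs_def q_in_def q_out_def B_def p_def
    by (simp add: if_distrib)
  \<comment> \<open>\<open>q_avg \<beta> p\<close> may be 1 for \<open>k = n - 1\<close>, but then every pair is a lattice edge.\<close>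
  have sub: "set_pmf (bernoulli_pmf (f (conj_perm \<pi> B i j))) \<subseteq> set_pmf (bernoulli_pmf (q_avg \<beta> p))"
    if \<pi>: "\<pi> permutes {..<n}" and ij: "(i, j) \<in> pairs n" for \<pi> i j
  proof (cases "p < 1")
    case True
    then have "set_pmf (bernoulli_pmf (q_avg \<beta> p)) = UNIV" using qa by simp
    then show ?thesis by simp
  next
    case False
    then have p1: "p = 1" using pb by simp
    then have "Suc k = n" using pe[unfolded p1] n3 by simp
    moreover have "inv \<pi> i < n" "inv \<pi> j < n" "inv \<pi> i \<noteq> inv \<pi> j"
      using permutes_in_image[OF permutes_inv[OF \<pi>]] permutes_inj[OF permutes_inv[OF \<pi>]] ij
      by (auto simp: pairs_def dest: injD)
    ultimately have "conj_perm \<pi> B i j"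
      unfolding conj_perm_def B_def using ek by (intro ring_lattice_complete) auto
    then show ?thesis by (simp add: f_def q_avg_def p1)
  qed
  have ent: "rel_entropy (P \<pi>) Q = ws_rel_entropy n k \<beta>" if \<pi>: "\<pi> permutes {..<n}" for \<pi>
  proof -
    let ?g = "\<lambda>b. bernoulli_rel_entropy (f b) (q_avg \<beta> p)"
    let ?L = "{(i, j) \<in> pairs n. B i j}"
    have "rel_entropy (P \<pi>) Q = (\<Sum>(i, j)\<in>pairs n. ?g (conj_perm \<pi> B i j))"
      unfolding P_def Q_def using sub[OF \<pi>] f qa pb
      by (subst rel_entropy_Pi_pmf) (auto intro!: sum.cong rel_entropy_bernoulli)
    also have "\<dots> = (\<Sum>(i, j)\<in>pairs n. ?g (B i j))"
      using \<pi> by (intro sum_conj_perm) (auto simp: B_def ring_lattice_sym)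
    also have "\<dots> = (\<Sum>(i, j)\<in>?L. ?g (B i j)) + (\<Sum>(i, j)\<in>pairs n - ?L. ?g (B i j))"
      by (subst add.commute, intro sum.subset_diff) auto
    also have "(\<Sum>(i, j)\<in>?L. ?g (B i j)) = (\<Sum>e\<in>?L. ?g True)"
      by (intro sum.cong) auto
    also have "(\<Sum>(i, j)\<in>pairs n - ?L. ?g (B i j)) = (\<Sum>e\<in>pairs n - ?L. ?g False)"
    proof (intro sum.cong refl)
      fix e assume "e \<in> pairs n - ?L"
      then show "(case e of (i, j) \<Rightarrow> ?g (B i j)) = ?g False" by (cases "B (fst e) (snd e)") auto
    qed
    also have "(\<Sum>e\<in>?L. ?g True) + (\<Sum>e\<in>pairs n - ?L. ?g False)
        = real (card ?L) * ?g True + (real (card (pairs n)) - real (card ?L)) * ?g False"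
    proof -
      have "finite ?L" "?L \<subseteq> pairs n" "card ?L \<le> card (pairs n)"
        by (auto intro: finite_subset[OF _ finite_pairs] card_mono)
      then show ?thesis by (simp add: card_Diff_subset of_nat_diff)
    qed
    \<comment> \<open>There are \<open>n * k / 2\<close> lattice edges, and
      \<open>k = (n - 1) * p\<close>.\<close>
    also have "real (card ?L) = real n * (real n - 1) / 2 * p"
    proof -
      have "real (k div 2) = real k / 2" using ek by auto
      then show ?thesis unfolding B_def card_ring_lattice[OF ek] using pe by (simp add: mult.assoc)
    qed
    finally show ?thesis
      unfolding ws_rel_entropy_def Let_def p_def[symmetric] card_pairs
      by (simp add: f_def algebra_simps)
  qed
  have perm: "\<pi> permutes {..<n}" if "\<pi> \<in> node_perms n" for \<pi> using that by (simp add: node_perms_def)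
  have "ln (card (node_perms n)) * (\<Sum>\<pi>\<in>node_perms n. measure_pmf.prob (P \<pi>) (h -` {A. \<phi> A = Some \<pi>}))
      \<le> card (node_perms n) * (ws_rel_entropy n k \<beta> + 1)"
  proof (rule fano)
    show "finite (node_perms n)" by (rule finite_node_perms)
    have "id \<in> node_perms n" by (simp add: node_perms_def permutes_id)
    then show "node_perms n \<noteq> {}" by auto
    show "disjoint_family_on (\<lambda>\<pi>. h -` {A. \<phi> A = Some \<pi>}) (node_perms n)"
      by (auto simp: disjoint_family_on_def)
    fix \<pi> assume "\<pi> \<in> node_perms n"
    note \<pi> = perm[OF this]
    show "finite (set_pmf (P \<pi>))"
      unfolding P_def by (auto simp: set_Pi_pmf intro!: finite_PiE_dflt)
    show "set_pmf (P \<pi>) \<subseteq> set_pmf Q"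
      using sub[OF \<pi>] unfolding P_def Q_def by (fastforce simp: set_Pi_pmf PiE_dflt_def)
    show "rel_entropy (P \<pi>) Q \<le> ws_rel_entropy n k \<beta>" using ent[OF \<pi>] by simp
  qed
  then show ?thesis using n3 by (simp add: card_node_perms WS)
qed

text \<open>Since the weights of the two chi-square bounds add up to 1, a pair costs at most
  \<open>(1 - \<beta>)\<^sup>2\<close> on average.\<close>

lemma ws_rel_entropy_le_square:
  assumes params: "ws_params n k \<beta>"
  shows "ws_rel_entropy n k \<beta> \<le> (real n)\<^sup>2 / 2 * (1 - \<beta>)\<^sup>2"
proof -
  define p where "p = real k / (real n - 1)"
  note pb = p_bounds[OF params p_def] and bb = beta_bounds[OF params p_def]
    and n3 = n_ge[OF params p_def]
  have "ws_rel_entropy n k \<beta> \<le> real n * (real n - 1) / 2 * ((1 - p) * (1 - \<beta>)\<^sup>2 + p * (1 - \<beta>)\<^sup>2)"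
    unfolding ws_rel_entropy_def Let_def p_def[symmetric]
    using n3 bernoulli_rel_entropy_in_le[OF bb pb] bernoulli_rel_entropy_out_le[OF bb pb]
    by (intro mult_left_mono add_mono) auto
  also have "\<dots> = real n * (real n - 1) / 2 * (1 - \<beta>)\<^sup>2" by (simp add: algebra_simps)
  also have "\<dots> \<le> (real n)\<^sup>2 / 2 * (1 - \<beta>)\<^sup>2"
    by (auto simp: power2_eq_square intro!: mult_right_mono mult_left_mono)
  finally show ?thesis .
qed

text \<open>Lattice edges are charged by the logarithmic bound, the others still by chi-square. Both
  bounds carry the factor \<open>p\<close>, which shrinks the prefactor
  \<open>n * (n - 1) / 2\<close> to \<open>n * k / 2\<close>.\<close>

lemma ws_rel_entropy_le_ln:
  assumes params: "ws_params n k \<beta>"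
  shows "ws_rel_entropy n k \<beta> \<le> real n * real k / 2 *
    ((1 - \<beta>) * (1 + ln (1 + 4 * (1 - \<beta>) * real n / (3 * real k))) + (1 - \<beta>)\<^sup>2)"
proof -
  define p where "p = real k / (real n - 1)"
  note pb = p_bounds[OF params p_def] and bb = beta_bounds[OF params p_def]
    and n3 = n_ge[OF params p_def] and pe = p_edges[OF params p_def]
  have k: "real k > 0" using params by (simp add: ws_params_def)
  have "4 * (1 - \<beta>) / (3 * p) = 4 * (1 - \<beta>) * (real n - 1) / (3 * real k)"
    using n3 k by (simp add: p_def)
  also have "\<dots> \<le> 4 * (1 - \<beta>) * real n / (3 * real k)"
    using bb by (intro divide_right_mono mult_left_mono) auto
  finally have r: "4 * (1 - \<beta>) / (3 * p) \<le> 4 * (1 - \<beta>) * real n / (3 * real k)" .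
  have r0: "0 \<le> 4 * (1 - \<beta>) / (3 * p)" using bb pb by simp
  have "ws_rel_entropy n k \<beta> \<le> real n * (real n - 1) / 2 *
      (p * ((1 - \<beta>) * (1 + ln (1 + 4 * (1 - \<beta>) / (3 * p)))) + p * (1 - \<beta>)\<^sup>2)"
    unfolding ws_rel_entropy_def Let_def p_def[symmetric]
    using n3 pb bernoulli_rel_entropy_in_le_ln[OF bb pb] bernoulli_rel_entropy_out_le[OF bb pb]
    by (intro mult_left_mono add_mono) auto
  also have "\<dots> = real n * ((real n - 1) * p) / 2 *
      ((1 - \<beta>) * (1 + ln (1 + 4 * (1 - \<beta>) / (3 * p))) + (1 - \<beta>)\<^sup>2)"
    by (simp add: algebra_simps)
  also have "\<dots> \<le> real n * real k / 2 *
      ((1 - \<beta>) * (1 + ln (1 + 4 * (1 - \<beta>) * real n / (3 * real k))) + (1 - \<beta>)\<^sup>2)"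
    unfolding pe using r r0 bb by (intro mult_left_mono add_mono) auto
  finally show ?thesis .
qed

text \<open>The constants balance the two entropy bounds against \<alpha> n ln n. The second
  condition splits at the truncation in \<open>ln1\<close>: for \<open>ln x \<le> 1\<close>,
  \<open>k\<^sup>2\<close> is at least of order n ln n and the square bound suffices again; for
  \<open>ln x > 1\<close> the logarithmic bound is used.\<close>

lemma ws_rel_entropy_le:
  assumes params: "ws_params n k \<beta>" and \<alpha>: "0 < \<alpha>" "\<alpha> < 1 / 8"
    and cond: "1 - \<beta> \<le> sqrt (2 * \<alpha>) * sqrt (ln (real n) / real n) \<or>
      1 - \<beta> \<le> \<alpha> / 2 * (ln (real n) / real k) * (1 / ln1 (real n * ln (real n) / (real k)\<^sup>2))"
  shows "ws_rel_entropy n k \<beta> \<le> \<alpha> * (real n * ln (real n))"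
proof -
  define e where "e = 1 - \<beta>"
  define x where "x = real n * ln (real n) / (real k)\<^sup>2"
  have bb: "0 \<le> e" "e \<le> 1" using beta_bounds[OF params refl] by (auto simp: e_def)
  have n3: "n \<ge> 3" using n_ge[OF params refl] .
  have k: "real k > 0" using params by (simp add: ws_params_def)
  have ln: "ln (real n) > 0" using n3 by simp
  have square: ?thesis if "e\<^sup>2 \<le> 2 * \<alpha> * (ln (real n) / real n)"
  proof -
    have "ws_rel_entropy n k \<beta> \<le> (real n)\<^sup>2 / 2 * e\<^sup>2"
      using ws_rel_entropy_le_square[OF params] by (simp add: e_def)
    also have "\<dots> \<le> (real n)\<^sup>2 / 2 * (2 * \<alpha> * (ln (real n) / real n))"
      using that by (intro mult_left_mono) auto
    also have "\<dots> = \<alpha> * (real n * ln (real n))" using n3 by (simp add: power2_eq_square)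
    finally show ?thesis .
  qed
  from cond consider
      "e \<le> sqrt (2 * \<alpha>) * sqrt (ln (real n) / real n)"
    | "e \<le> \<alpha> / 2 * (ln (real n) / real k) * (1 / ln1 x)" "ln x \<le> 1"
    | "e \<le> \<alpha> / 2 * (ln (real n) / real k) * (1 / ln1 x)" "ln x > 1"
    unfolding e_def x_def by linarith
  then show ?thesis
  proof cases
    case 1
    then have "e\<^sup>2 \<le> (sqrt (2 * \<alpha>) * sqrt (ln (real n) / real n))\<^sup>2"
      using bb by (intro power_mono) auto
    also have "\<dots> = 2 * \<alpha> * (ln (real n) / real n)"
      using \<alpha> ln by (simp add: power_mult_distrib)
    finally show ?thesis by (rule square)
  next
    case 2
    have x0: "x > 0" using ln n3 k by (simp add: x_def)
    then have "x \<le> exp 1" using 2 by (metis exp_le_cancel_iff exp_ln)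
    then have x3: "x \<le> 3" using exp_le by linarith
    have "e\<^sup>2 \<le> (\<alpha> / 2 * (ln (real n) / real k))\<^sup>2"
      using 2 bb by (intro power_mono) (auto simp: ln1_def)
    \<comment> \<open>The definition of \<open>x\<close> gives
      \<open>(ln n / k)\<^sup>2 = x * (ln n / n)\<close>.\<close>
    also have "\<dots> = \<alpha> / 4 * \<alpha> * x * (ln (real n) / real n)"
      using n3 k by (simp add: x_def power2_eq_square field_simps)
    also have "\<dots> \<le> \<alpha> / 4 * 1 * 3 * (ln (real n) / real n)"
      using \<alpha> x3 x0 ln by (intro mult_right_mono mult_mono) auto
    also have "\<dots> \<le> 2 * \<alpha> * (ln (real n) / real n)"
      using \<alpha> ln by (intro mult_right_mono) auto
    finally show ?thesis by (rule square)
  next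
    case 3
    define L where "L = ln x"
    have L: "L > 1" "ln1 x = L" using 3 by (auto simp: L_def ln1_def)
    have x0: "x > 0" using ln n3 k by (simp add: x_def)
    have x1: "x > 1" using 3 x0 by (metis less_trans ln_gt_zero_iff zero_less_one)
    have eL: "e * L \<le> \<alpha> / 2 * (ln (real n) / real k)"
    proof -
      have "e \<le> \<alpha> / 2 * (ln (real n) / real k) / L" using 3(1) unfolding L(2) by simp
      then show ?thesis by (subst (asm) pos_le_divide_eq) (use L in auto)
    qed
    have "e * 1 \<le> e * L" using L bb by (intro mult_left_mono) auto
    then have "e \<le> \<alpha> / 2 * (ln (real n) / real k)" using eL by simp
    \<comment> \<open>The hypothesis bounds \<open>e\<close> itself, and so the ratio inside the
      logarithm by \<open>2 / 3 * \<alpha> * x\<close>, below the very \<open>x\<close> whose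
      logarithm is \<open>L\<close>.\<close>
    then have "4 / 3 * (real n / real k) * e \<le> 4 / 3 * (real n / real k) * (\<alpha> / 2 * (ln (real n) / real k))"
      using k by (intro mult_left_mono) auto
    also have "\<dots> = 2 / 3 * \<alpha> * x" by (simp add: x_def power2_eq_square)
    also have "\<dots> \<le> 1 * x" using \<alpha> x0 by (intro mult_right_mono) auto
    finally have r: "4 * e * real n / (3 * real k) \<le> x" by (simp add: mult_ac)
    have r0: "0 \<le> 4 * e * real n / (3 * real k)" using bb by simp
    have "ln (1 + 4 * e * real n / (3 * real k)) \<le> ln (exp 1 * x)"
    proof (subst ln_le_cancel_iff)
      have "2 * x \<le> exp 1 * x" using x0 exp_ge_add_one_self[of 1] by (intro mult_right_mono) auto
      then show "1 + 4 * e * real n / (3 * real k) \<le> exp 1 * x" using r x1 by linarith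
    qed (use r0 x0 in auto)
    also have "\<dots> = 1 + L" using x0 by (simp add: ln_mult L_def)
    finally have l: "ln (1 + 4 * e * real n / (3 * real k)) \<le> 1 + L" .
    have "ws_rel_entropy n k \<beta> \<le> real n * real k / 2 *
        (e * (1 + ln (1 + 4 * e * real n / (3 * real k))) + e\<^sup>2)"
      using ws_rel_entropy_le_ln[OF params] by (simp add: e_def)
    also have "\<dots> \<le> real n * real k / 2 * (e * (1 + (1 + L)) + e * 1)"
      unfolding power2_eq_square using l bb by (intro mult_left_mono add_mono) auto
    also have "\<dots> = real n * real k / 2 * (e * (3 + L))" by (simp add: algebra_simps)
    \<comment> \<open>\<open>L > 1\<close> yields the factor 4, which against the 1/2 in front
      leaves 2; this is why the second constant is \<open>\<alpha> / 2\<close>.\<close>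
    also have "\<dots> \<le> real n * real k / 2 * (e * (4 * L))"
      using L bb by (intro mult_left_mono) auto
    also have "\<dots> = real n * real k * 2 * (e * L)" by simp
    also have "\<dots> \<le> real n * real k * 2 * (\<alpha> / 2 * (ln (real n) / real k))"
      using eL by (intro mult_left_mono) auto
    also have "\<dots> = \<alpha> * (real n * ln (real n))" using k by simp
    finally show ?thesis .
  qed
qed

section \<open>From the relative entropy to the error\<close>

lemma average_error_eq:
  assumes "n > 0"
  shows "1 / fact (n - 1) * (\<Sum>\<pi>\<in>node_perms n. measure_pmf.prob (WS n k \<beta> \<pi>) {A. \<phi> A \<noteq> Some \<pi>})
    = 1 - (\<Sum>\<pi>\<in>node_perms n. measure_pmf.prob (WS n k \<beta> \<pi>) {A. \<phi> A = Some \<pi>}) / fact (n - 1)"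
proof -
  have "measure_pmf.prob (WS n k \<beta> \<pi>) {A. \<phi> A \<noteq> Some \<pi>}
      = 1 - measure_pmf.prob (WS n k \<beta> \<pi>) {A. \<phi> A = Some \<pi>}" for \<pi>
    by (subst measure_pmf.prob_compl[symmetric]) (auto simp: Collect_neg_eq Compl_eq_Diff_UNIV)
  then have "(\<Sum>\<pi>\<in>node_perms n. measure_pmf.prob (WS n k \<beta> \<pi>) {A. \<phi> A \<noteq> Some \<pi>})
      = fact (n - 1) - (\<Sum>\<pi>\<in>node_perms n. measure_pmf.prob (WS n k \<beta> \<pi>) {A. \<phi> A = Some \<pi>})"
    using assms by (simp only: sum_subtractf) (simp add: card_node_perms)
  then show ?thesis by (simp add: diff_divide_distrib)
qed

text \<open>Dividing Fano's inequality by \<open>ln (fact (n - 1))\<close>, positive for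
  \<open>n \<ge> 3\<close>, bounds the average probability of a correct decision by 2\<alpha>. The
  second argument of the maximum is thus large.\<close>

lemma max_error_ge:
  assumes params: "ws_params n k \<beta>"
    and "ws_rel_entropy n k \<beta> + 1 \<le> 2 * \<alpha> * ln (fact (n - 1))"
  shows "1 - 2 * \<alpha> \<le> max_error n k \<beta> \<phi>"
proof -
  let ?s = "\<Sum>\<pi>\<in>node_perms n. measure_pmf.prob (WS n k \<beta> \<pi>) {A. \<phi> A = Some \<pi>}"
  have n3: "n \<ge> 3" using n_ge[OF params refl] .
  have "1 < (fact (n - 1) :: real)"
    using n3 fact_less_mono[of 1 "n - 1", where ?'a = real] by simp
  then have l: "ln (fact (n - 1)) > (0 :: real)" by simp
  have "ln (fact (n - 1)) * ?s \<le> fact (n - 1) * (ws_rel_entropy n k \<beta> + 1)"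
    by (rule sum_prob_correct_le[OF params])
  also have "\<dots> \<le> fact (n - 1) * (2 * \<alpha> * ln (fact (n - 1)))"
    using assms(2) by (intro mult_left_mono) auto
  finally have "ln (fact (n - 1)) * ?s \<le> ln (fact (n - 1)) * (2 * \<alpha> * fact (n - 1))"
    by (simp add: mult_ac)
  then have "?s \<le> 2 * \<alpha> * fact (n - 1)" using l by (simp only: mult_le_cancel_left_pos)
  then have "?s / fact (n - 1) \<le> 2 * \<alpha>" by (simp add: divide_le_eq)
  then show ?thesis unfolding max_error_def using average_error_eq[of n k \<beta> \<phi>] n3 by simp
qed

subsection \<open>The reflection of the ring\<close>

text \<open>Negation modulo \<open>n\<close>, with 0 apart because \<open>n - 0\<close> is out of
  range, and the identity beyond the nodes, as \<open>permutes\<close> demands.\<close>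

definition node_reflection :: "nat \<Rightarrow> nat \<Rightarrow> nat" where
  "node_reflection n i = (if 0 < i \<and> i < n then n - i else i)"

lemma node_reflection_involution: "node_reflection n \<circ> node_reflection n = id"
  by (auto simp: node_reflection_def fun_eq_iff)

text \<open>For nonzero nodes the reflection keeps \<open>|i - j|\<close>; if exactly one of them is
  0, it exchanges \<open>|i - j|\<close> and \<open>n - |i - j|\<close>, and the minimum is
  symmetric in these.\<close>

lemma ring_lattice_node_reflection:
  "ring_lattice n k (node_reflection n i) (node_reflection n j) = ring_lattice n k i j"
proof (cases "i < n \<and> j < n")
  case True
  then have "ring_dist n (node_reflection n i) (node_reflection n j) = ring_dist n i j"
    by (auto simp: ring_dist_def node_reflection_def)
  moreover have "node_reflection n i < n" "node_reflection n j < n"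
      "node_reflection n i = node_reflection n j \<longleftrightarrow> i = j"
    using True by (auto simp: node_reflection_def)
  ultimately show ?thesis using True by (simp add: ring_lattice_def)
qed (auto simp: ring_lattice_def node_reflection_def)

lemma node_reflection_permutes: "node_reflection n permutes {1..<n}"
proof (rule bij_imp_permutes)
  show "bij_betw (node_reflection n) {1..<n} {1..<n}"
    by (rule bij_betw_byWitness[where f' = "node_reflection n"]) (auto simp: node_reflection_def)
qed (auto simp: node_reflection_def)

text \<open>\<open>conj_perm\<close> uses the inverse, so a reflection composed on the right acts
  directly on the arguments of the lattice.\<close>

lemma WS_comp_node_reflection:
  assumes "bij \<pi>"
  shows "WS n k \<beta> (\<pi> \<circ> node_reflection n) = WS n k \<beta> \<pi>"
proof -
  have bij: "bij (node_reflection n)" using o_bij node_reflection_involution by blast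
  have "inv (node_reflection n) = node_reflection n"
    using node_reflection_involution by (metis inv_unique_comp)
  then have "inv (\<pi> \<circ> node_reflection n) = node_reflection n \<circ> inv \<pi>"
    using o_inv_distrib[OF assms bij] by simp
  then have "conj_perm (\<pi> \<circ> node_reflection n) (ring_lattice n k) = conj_perm \<pi> (ring_lattice n k)"
    by (simp add: conj_perm_def fun_eq_iff ring_lattice_node_reflection)
  then show ?thesis by (simp add: WS_def)
qed

text \<open>Under the law shared by \<open>\<pi>\<close> and its composition with the reflection,
  the decisions for the two are disjoint events, so their success probabilities add up to at most
  1.\<close>

lemma max_error_ge_half:
  assumes n: "n \<ge> 3"
  shows "1 / 2 \<le> max_error n k \<beta> \<phi>"
proof -
  let ?\<rho> = "node_reflection n" and ?S = "node_perms n"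
  let ?f = "\<lambda>\<pi>. measure_pmf.prob (WS n k \<beta> \<pi>) {A. \<phi> A = Some \<pi>}"
  have S: "\<pi> \<circ> ?\<rho> \<in> ?S" if "\<pi> \<in> ?S" for \<pi>
    using that n node_reflection_permutes by (simp add: node_perms_eq permutes_compose)
  have inv: "\<pi> \<circ> ?\<rho> \<circ> ?\<rho> = \<pi>" for \<pi> :: "nat \<Rightarrow> nat"
    by (simp add: comp_assoc node_reflection_involution)
  have "(\<Sum>\<pi>\<in>?S. ?f \<pi>) = (\<Sum>\<pi>\<in>?S. ?f (\<pi> \<circ> ?\<rho>))"
    by (rule sum.reindex_bij_witness[of _ "\<lambda>\<pi>. \<pi> \<circ> ?\<rho>" "\<lambda>\<pi>. \<pi> \<circ> ?\<rho>"]) (auto simp: inv S)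
  then have "2 * (\<Sum>\<pi>\<in>?S. ?f \<pi>) = (\<Sum>\<pi>\<in>?S. ?f \<pi> + ?f (\<pi> \<circ> ?\<rho>))"
    by (simp add: sum.distrib)
  also have "\<dots> \<le> (\<Sum>\<pi>\<in>?S. 1)"
  proof (intro sum_mono)
    fix \<pi> assume "\<pi> \<in> ?S"
    then have \<pi>: "bij \<pi>" by (auto simp: node_perms_def permutes_bij)
    \<comment> \<open>Node 1 shows that the reflection is not the identity: \<open>n - 1 = 1\<close>
      would mean \<open>n = 2\<close>.\<close>
    have "?\<rho> 1 \<noteq> 1" using n by (simp add: node_reflection_def)
    then have "(\<pi> \<circ> ?\<rho>) 1 \<noteq> \<pi> 1" using bij_is_inj[OF \<pi>] by (auto dest: injD)
    then have ne: "\<pi> \<circ> ?\<rho> \<noteq> \<pi>" by metis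
    have "?f \<pi> + ?f (\<pi> \<circ> ?\<rho>)
        = measure_pmf.prob (WS n k \<beta> \<pi>) ({A. \<phi> A = Some \<pi>} \<union> {A. \<phi> A = Some (\<pi> \<circ> ?\<rho>)})"
      unfolding WS_comp_node_reflection[OF \<pi>] using ne
      by (intro measure_pmf.finite_measure_Union[symmetric]) auto
    then show "?f \<pi> + ?f (\<pi> \<circ> ?\<rho>) \<le> 1" by simp
  qed
  also have "\<dots> = fact (n - 1)" using n by (simp add: card_node_perms)
  finally have "(\<Sum>\<pi>\<in>?S. ?f \<pi>) / fact (n - 1) \<le> 1 / 2" by (simp add: field_simps)
  then show ?thesis unfolding max_error_def le_max_iff_disj using average_error_eq[of n k \<beta> \<phi>] n by simp
qed

subsection \<open>The lower bound\<close>

theorem theorem1: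
  shows "(\<forall>\<alpha>::real. 0 < \<alpha> \<and> \<alpha> < 1/8 \<longrightarrow>
           (\<exists>C>0. \<exists>C'>0. \<forall>(k :: nat \<Rightarrow> nat) (\<beta> :: nat \<Rightarrow> real).
              (\<forall>\<^sub>F n in sequentially. ws_params n (k n) (\<beta> n)) \<longrightarrow>
              (\<forall>\<^sub>F n in sequentially.
                 1 - \<beta> n \<le> C * sqrt (ln (real n) / real n) \<or>
                 1 - \<beta> n \<le> C' * (ln (real n) / real (k n)) *
                            (1 / ln1 (real n * ln (real n) / (real (k n))\<^sup>2))) \<longrightarrow>
              ereal (1 - 2 * \<alpha>) \<le> liminf (\<lambda>n. ereal (minimax_error n (k n) (\<beta> n))))) \<and>
         (\<forall>(k :: nat \<Rightarrow> nat) (\<beta> :: nat \<Rightarrow> real).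
            (\<forall>\<^sub>F n in sequentially. ws_params n (k n) (\<beta> n)) \<longrightarrow>
            (\<lambda>n. 1 - \<beta> n) \<prec>
              (\<lambda>n. max (sqrt (ln (real n) / real n)) (ln (real n) / real (k n))) \<longrightarrow>
            \<not> (\<exists>\<phi>. (\<forall>n. \<phi> n \<in> selectors n) \<and>
                   (\<lambda>n. max_error n (k n) (\<beta> n) (\<phi> n)) \<longlonglongrightarrow> 0))"
proof (intro conjI allI impI)
  fix \<alpha> :: real assume \<alpha>: "0 < \<alpha> \<and> \<alpha> < 1 / 8"
  show "\<exists>C>0. \<exists>C'>0. \<forall>(k :: nat \<Rightarrow> nat) (\<beta> :: nat \<Rightarrow> real).
              (\<forall>\<^sub>F n in sequentially. ws_params n (k n) (\<beta> n)) \<longrightarrow>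
              (\<forall>\<^sub>F n in sequentially.
                 1 - \<beta> n \<le> C * sqrt (ln (real n) / real n) \<or>
                 1 - \<beta> n \<le> C' * (ln (real n) / real (k n)) *
                            (1 / ln1 (real n * ln (real n) / (real (k n))\<^sup>2))) \<longrightarrow>
              ereal (1 - 2 * \<alpha>) \<le> liminf (\<lambda>n. ereal (minimax_error n (k n) (\<beta> n)))"
  \<comment> \<open>The constants of \<open>ws_rel_entropy_le\<close>; both depend on \<alpha>
    only.\<close>
  proof (rule exI[of _ "sqrt (2 * \<alpha>)"], rule conjI, use \<alpha> in simp,
      rule exI[of _ "\<alpha> / 2"], rule conjI, use \<alpha> in simp, intro allI impI)
    fix k :: "nat \<Rightarrow> nat" and \<beta> :: "nat \<Rightarrow> real"
    assume "\<forall>\<^sub>F n in sequentially. ws_params n (k n) (\<beta> n)"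
      and "\<forall>\<^sub>F n in sequentially. 1 - \<beta> n \<le> sqrt (2 * \<alpha>) * sqrt (ln (real n) / real n) \<or>
         1 - \<beta> n \<le> \<alpha> / 2 * (ln (real n) / real (k n)) *
            (1 / ln1 (real n * ln (real n) / (real (k n))\<^sup>2))"
    moreover have "\<forall>\<^sub>F n in sequentially.
        \<alpha> * (real n * ln (real n)) + 1 \<le> 2 * \<alpha> * ln (fact (n - 1))"
      using \<alpha> by (intro eventually_le_ln_fact) simp
    ultimately have "\<forall>\<^sub>F n in sequentially. 1 - 2 * \<alpha> \<le> minimax_error n (k n) (\<beta> n)"
    proof eventually_elim
      case (elim n)
      have "ws_rel_entropy n (k n) (\<beta> n) + 1 \<le> 2 * \<alpha> * ln (fact (n - 1))"
        using ws_rel_entropy_le[OF elim(1) _ _ elim(2)] elim(3) \<alpha> by linarith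
      then show ?case
        unfolding minimax_error_def
        using finite_selectors selectors_nonempty max_error_ge[OF elim(1)]
        by (intro Min.boundedI) auto
    qed
    then show "ereal (1 - 2 * \<alpha>) \<le> liminf (\<lambda>n. ereal (minimax_error n (k n) (\<beta> n)))"
      by (intro Liminf_bounded) simp
  qed
next
  fix k :: "nat \<Rightarrow> nat" and \<beta> :: "nat \<Rightarrow> real"
  show "\<not> (\<exists>\<phi>. (\<forall>n. \<phi> n \<in> selectors n) \<and> (\<lambda>n. max_error n (k n) (\<beta> n) (\<phi> n)) \<longlonglongrightarrow> 0)"
  proof
    assume "\<exists>\<phi>. (\<forall>n. \<phi> n \<in> selectors n) \<and> (\<lambda>n. max_error n (k n) (\<beta> n) (\<phi> n)) \<longlonglongrightarrow> 0"
    then obtain \<phi> where "(\<lambda>n. max_error n (k n) (\<beta> n) (\<phi> n)) \<longlonglongrightarrow> 0" by blast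
    \<comment> \<open>The errors are at least 1/2 from \<open>n = 3\<close> on, and so would be
      their limit.\<close>
    then have "(1 :: real) / 2 \<le> 0"
      by (rule tendsto_lowerbound)
         (rule eventually_mono[OF eventually_ge_at_top[of 3] max_error_ge_half], simp_all)
    then show False by simp
  qed
qed

end
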